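(* Let $\mathfrak{g}=\mathfrak{g}_{4.1}$ be the four-dimensional real Lie algebra with basis $\mathcal{B}=\{e_1,e_2,e_3,e_4\}$ whose nonzero Lie brackets (up to skew-symmetry) are $[e_2,e_4]=e_1$, $[e_3,e_4]=e_2$. Let $\langle\cdot,\cdot\rangle$ be a pseudo-Riemannian inner product on $\mathfrak{g}$ and let $(R_{ij})$ be the matrix of its Ricci operator $\operatorname{Ric}$ in the basis $\mathcal{B}$. If $$R_{i1}=0\ (i=2,3,4),\quad R_{32}=R_{42}=R_{43}=0,\quad R_{23}=R_{12},\quad R_{22}+R_{44}-R_{11}=R_{33}+R_{44}-R_{22},$$ then $\langle\cdot,\cdot\rangle$ is an algebraic Ricci soliton. Given these relations, $\operatorname{Ric}=\eta I_4+D$ where $\eta=R_{22}+R_{44}-R_{11}=R_{33}+R_{44}-R_{22}$ and $$D=\begin{bmatrix}R_{11}-\eta&R_{12}&R_{13}&R_{14}\\0&R_{22}-\eta&R_{12}&R_{24}\\0&0&R_{33}-\eta&R_{34}\\0&0&0&R_{44}-\eta\end{bmatrix}$$ is (the matrix in the basis $\mathcal{B}$ of) a derivation of $\mathfrak{g}$.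
   Context: A pseudo-Riemannian inner product on a real Lie algebra $\mathfrak{g}$ is a nondegenerate symmetric bilinear form $\langle\cdot,\cdot\rangle$ on $\mathfrak{g}$ (of some signature $(r,s)$). Its Levi-Civita connection $\nabla$ is defined by $2\langle\nabla_uv,w\rangle=\langle[u,v],w\rangle+\langle[w,u],v\rangle+\langle[w,v],u\rangle$; its curvature is $R_{uv}=\nabla_{[u,v]}-[\nabla_u,\nabla_v]$; its Ricci curvature $\operatorname{ric}(u,v)$ is the trace of $w\mapsto R_{uw}v$; its Ricci operator $\operatorname{Ric}$ is the endomorphism of $\mathfrak{g}$ with $\langle\operatorname{Ric}(u),v\rangle=\operatorname{ric}(u,v)$. The matrix $(R_{ij})$ of $\operatorname{Ric}$ in a basis $\{e_i\}$ is given by $\operatorname{Ric}(e_j)=\sum_iR_{ij}e_i$ (the same column convention is used for $D$). A derivation is a linear map $D:\mathfrak{g}\to\mathfrak{g}$ with $D[x,y]=[D(x),y]+[x,D(y)]$ for all $x,y$. The inner product is an algebraic Ricci soliton if $\operatorname{Ric}=\eta\,\mathrm{Id}_{\mathfrak{g}}+D$ for some $\eta\in\mathbb{R}$ and some derivation $D$ of $\mathfrak{g}$. *)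

theory Defs
  imports "HOL-Analysis.Analysis"
begin

definition lie_bracket :: "('a::real_vector \<Rightarrow> 'a \<Rightarrow> 'a) \<Rightarrow> bool" where
  "lie_bracket br \<longleftrightarrow> bilinear br \<and> (\<forall>x. br x x = 0) \<and>
     (\<forall>x y z. br x (br y z) + br y (br z x) + br z (br x y) = 0)"

definition derivation :: "('a::real_vector \<Rightarrow> 'a \<Rightarrow> 'a) \<Rightarrow> ('a \<Rightarrow> 'a) \<Rightarrow> bool" where
  "derivation br D \<longleftrightarrow> linear D \<and> (\<forall>x y. D (br x y) = br (D x) y + br x (D y))"

text \<open>No signature is prescribed: every signature is allowed, including the definite ones.\<close>

definition pseudo_riemannian :: "('a::real_vector \<Rightarrow> 'a \<Rightarrow> real) \<Rightarrow> bool" where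
  "pseudo_riemannian g \<longleftrightarrow> bilinear g \<and> (\<forall>x y. g x y = g y x) \<and>
     (\<forall>x. (\<forall>y. g x y = 0) \<longrightarrow> x = 0)"

text \<open>The two definite descriptions below (connection and Ricci operator) are uniquely satisfied
  whenever the bracket is bilinear and the form is pseudo-Riemannian, see
  \<open>levi_civita_eq\<close> and \<open>ricci_operator_eq\<close>.\<close>

definition levi_civita ::
    "('a \<Rightarrow> 'a \<Rightarrow> 'a) \<Rightarrow> ('a \<Rightarrow> 'a \<Rightarrow> real) \<Rightarrow> 'a::real_vector \<Rightarrow> 'a \<Rightarrow> 'a" where
  "levi_civita br g u v =
     (THE x. \<forall>w. 2 * g x w = g (br u v) w + g (br w u) v + g (br w v) u)"

text \<open>Sign convention: \<open>R u v = \<nabla> [u,v] - [\<nabla> u, \<nabla> v]\<close>.\<close>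

definition curvature ::
    "('a \<Rightarrow> 'a \<Rightarrow> 'a) \<Rightarrow> ('a \<Rightarrow> 'a \<Rightarrow> real) \<Rightarrow> 'a::real_vector \<Rightarrow> 'a \<Rightarrow> 'a \<Rightarrow> 'a" where
  "curvature br g u v w =
     levi_civita br g (br u v) w -
     (levi_civita br g u (levi_civita br g v w) - levi_civita br g v (levi_civita br g u w))"

definition ricci ::
    "(real^'n \<Rightarrow> real^'n \<Rightarrow> real^'n) \<Rightarrow> (real^'n \<Rightarrow> real^'n \<Rightarrow> real) \<Rightarrow> real^'n \<Rightarrow> real^'n \<Rightarrow> real" where
  "ricci br g u v = trace (matrix (\<lambda>w. curvature br g u w v))"

definition ricci_operator ::
    "(real^'n \<Rightarrow> real^'n \<Rightarrow> real^'n) \<Rightarrow> (real^'n \<Rightarrow> real^'n \<Rightarrow> real) \<Rightarrow> real^'n \<Rightarrow> real^'n" where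
  "ricci_operator br g u = (THE x. \<forall>v. g x v = ricci br g u v)"

definition algebraic_ricci_soliton ::
    "(real^'n \<Rightarrow> real^'n \<Rightarrow> real^'n) \<Rightarrow> (real^'n \<Rightarrow> real^'n \<Rightarrow> real) \<Rightarrow> bool" where
  "algebraic_ricci_soliton br g \<longleftrightarrow>
     (\<exists>\<eta> D. derivation br D \<and> (\<forall>x. ricci_operator br g x = \<eta> *\<^sub>R x + D x))"

text \<open>The Lie algebra \<open>\<gg>\<^sub>4\<^sub>.\<^sub>1\<close>, realised on \<open>real^4\<close> with \<open>axis i 1\<close> as the basis vector \<open>e\<^sub>i\<close>
  (so that \<open>matrix\<close> gives matrices with respect to this basis, images of basis vectors as columns).
  The formula is the bilinear skew-symmetric extension of \<open>[e\<^sub>2,e\<^sub>4] = e\<^sub>1\<close>, \<open>[e\<^sub>3,e\<^sub>4] = e\<^sub>2\<close>.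
  In the index type \<open>4\<close> the numeral \<open>4\<close> denotes the same element as \<open>0\<close>; the four indices
  1, 2, 3, 4 are distinct.\<close>

definition g41_bracket :: "real^4 \<Rightarrow> real^4 \<Rightarrow> real^4" where
  "g41_bracket x y =
     (x $ 2 * y $ 4 - x $ 4 * y $ 2) *\<^sub>R axis 1 1 + (x $ 3 * y $ 4 - x $ 4 * y $ 3) *\<^sub>R axis 2 1"

lemma g41_bracket_basis:
  "g41_bracket (axis 2 1) (axis 4 1) = axis 1 1"
  "g41_bracket (axis 3 1) (axis 4 1) = axis 2 1"
  "g41_bracket (axis 1 1) (axis i 1) = 0"
  "g41_bracket (axis 2 1) (axis 3 1) = 0"
  by (auto simp: g41_bracket_def axis_def vec_eq_iff)

lemma lie_bracket_g41: "lie_bracket g41_bracket"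
  unfolding lie_bracket_def bilinear_def
  by (auto simp: g41_bracket_def axis_def vec_eq_iff forall_4 algebra_simps intro!: linearI)

lemma pseudo_riemannian_represent:
  fixes g :: "real^'n \<Rightarrow> real^'n \<Rightarrow> real"
  assumes "pseudo_riemannian g" "linear f"
  shows "\<exists>!x. \<forall>w. g x w = f w"
proof -
  define T where "T = (\<lambda>x. \<chi> i. g x (axis i 1))"
  have bl: "bilinear g" and nd: "\<And>x. (\<forall>y. g x y = 0) \<Longrightarrow> x = 0"
    using assms(1) by (auto simp: pseudo_riemannian_def)
  have lg: "linear (g x)" for x using bl by (simp add: bilinear_def)
  have ext: "(\<forall>w. h w = k w)"
    if "linear h" "linear k" "\<And>i. h (axis i 1) = k (axis i 1)"
    for h k :: "real^'n \<Rightarrow> real"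
  proof
    fix w
    have "h w = k w" if "w \<in> span Basis" for w
      by (rule linear_eq_on[OF \<open>linear h\<close> \<open>linear k\<close> that])
        (auto simp: Basis_vec_def \<open>\<And>i. h (axis i 1) = k (axis i 1)\<close>)
    then show "h w = k w" by simp
  qed
  have linT: "linear T"
    by (rule linearI)
      (auto simp: T_def vec_eq_iff bilinear_ladd[OF bl] bilinear_lmul[OF bl])
  have inj: "inj T"
    unfolding linear_injective_0[OF linT]
  proof (intro allI impI)
    fix x assume "T x = 0"
    then have "\<forall>w. g x w = (\<lambda>_. 0) w"
      by (intro ext[OF lg]) (auto simp: T_def vec_eq_iff linear_zero)
    then show "x = 0" by (intro nd) simp
  qed
  then have "surj T" using linT by (simp add: linear_injective_imp_surjective)
  then obtain x where x: "T x = (\<chi> i. f (axis i 1))" by (metis surjD)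
  have "\<forall>w. g x w = f w"
    by (rule ext[OF lg assms(2)]) (use x in \<open>auto simp: T_def vec_eq_iff\<close>)
  moreover have "y = x" if "\<forall>w. g y w = f w" for y
    using inj that calculation by (auto simp: T_def inj_def)
  ultimately show ?thesis by blast
qed

lemma levi_civita_eq:
  fixes g :: "real^'n \<Rightarrow> real^'n \<Rightarrow> real"
  assumes g: "pseudo_riemannian g" and br: "bilinear br"
  shows "2 * g (levi_civita br g u v) w = g (br u v) w + g (br w u) v + g (br w v) u"
proof -
  have bl: "bilinear g" using g by (auto simp: pseudo_riemannian_def)
  let ?f = "\<lambda>w. (g (br u v) w + g (br w u) v + g (br w v) u) / 2"
  have "linear ?f"
    by (rule linearI) (simp_all add: bilinear_ladd[OF bl] bilinear_ladd[OF br]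
      bilinear_radd[OF bl] bilinear_lmul[OF bl] bilinear_lmul[OF br] bilinear_rmul[OF bl] algebra_simps add_divide_distrib)
  from pseudo_riemannian_represent[OF g this]
  have "\<exists>!x. \<forall>w. 2 * g x w = g (br u v) w + g (br w u) v + g (br w v) u"
    by (simp add: field_simps)
  from theI'[OF this] show ?thesis by (simp add: levi_civita_def)
qed

lemma levi_civita_unique:
  fixes g :: "real^'n \<Rightarrow> real^'n \<Rightarrow> real"
  assumes g: "pseudo_riemannian g" and br: "bilinear br"
    and x: "\<And>w. 2 * g x w = g (br u v) w + g (br w u) v + g (br w v) u"
  shows "levi_civita br g u v = x"
proof -
  have bl: "bilinear g" using g by (auto simp: pseudo_riemannian_def)
  have "g (levi_civita br g u v - x) w = 0" for w
    using levi_civita_eq[OF g br, of u v w] x[of w] by (simp add: bilinear_lsub[OF bl])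
  then have "levi_civita br g u v - x = 0" using g unfolding pseudo_riemannian_def by blast
  then show ?thesis by simp
qed

lemma bilinear_levi_civita:
  fixes g :: "real^'n \<Rightarrow> real^'n \<Rightarrow> real"
  assumes g: "pseudo_riemannian g" and br: "bilinear br"
  shows "bilinear (levi_civita br g)"
proof -
  have bl: "bilinear g" using g by (auto simp: pseudo_riemannian_def)
  note s = bilinear_ladd[OF bl] bilinear_ladd[OF br] bilinear_radd[OF bl] bilinear_radd[OF br]
    bilinear_lmul[OF bl] bilinear_lmul[OF br] bilinear_rmul[OF bl] bilinear_rmul[OF br]
  note e = levi_civita_eq[OF g br]
  show ?thesis unfolding bilinear_def
    by (intro conjI allI linearI levi_civita_unique[OF g br])
      (simp_all add: s e algebra_simps distrib_left
        mult.left_commute[of 2])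
qed

lemma ricci_operator_eq:
  fixes g :: "real^'n \<Rightarrow> real^'n \<Rightarrow> real"
  assumes g: "pseudo_riemannian g" and br: "bilinear br"
  shows "g (ricci_operator br g u) v = ricci br g u v"
proof -
  note L = bilinear_levi_civita[OF g br]
  have "linear (ricci br g u)"
    by (rule linearI)
      (simp_all add: ricci_def trace_def matrix_def curvature_def bilinear_radd[OF L]
        bilinear_rmul[OF L] sum.distrib sum_subtractf sum_distrib_left algebra_simps)
  from theI'[OF pseudo_riemannian_represent[OF g this]]
  show ?thesis by (simp add: ricci_operator_def)
qed

end

theory Submission
  imports Defs
begin

text \<open>The geometry enters through the linearity of the Ricci operator
  (\<open>linear_ricci_operator\<close>), which identifies it with multiplication by
  \<open>R\<close>. Put \<open>D = R - \<eta> I\<close>. The vanishing entries and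
  \<open>R$2$3 = R$1$2\<close> give \<open>D\<close> the displayed triangular shape, and the two
  expressions for \<eta> become the diagonal relations D11 = D22 + D44 and D22 = D33 + D44. By
  \<open>derivation_g41\<close> such a matrix is a derivation.\<close>

text \<open>\<open>ricci br g u v\<close> is linear in \<open>u\<close> because bracket and
  connection are bilinear and the trace is linear; nondegeneracy of \<open>g\<close> carries this
  over to the vector that represents it.\<close>

lemma linear_ricci_operator:
  fixes g :: "real^'n \<Rightarrow> real^'n \<Rightarrow> real"
  assumes g: "pseudo_riemannian g" and br: "bilinear br"
  shows "linear (ricci_operator br g)"
proof -
  have bl: "bilinear g" using g by (simp add: pseudo_riemannian_def)
  note L = bilinear_levi_civita[OF g br]
  note e = ricci_operator_eq[OF g br]
  have eqI: "x = y" if "\<And>v. g x v = g y v" for x y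
  proof -
    have "\<forall>v. g (x - y) v = 0" using that by (simp add: bilinear_lsub[OF bl])
    then have "x - y = 0" using g unfolding pseudo_riemannian_def by blast
    then show ?thesis by simp
  qed
  note s = ricci_def trace_def matrix_def curvature_def
    bilinear_ladd[OF br] bilinear_lmul[OF br] bilinear_ladd[OF L] bilinear_lmul[OF L]
    bilinear_radd[OF L] bilinear_rmul[OF L]
  have add: "ricci br g (u + u') v = ricci br g u v + ricci br g u' v" for u u' v
    by (simp add: s sum.distrib sum_subtractf algebra_simps)
  have scale: "ricci br g (c *\<^sub>R u) v = c * ricci br g u v" for c u v
    by (simp add: s sum.distrib sum_subtractf sum_distrib_left algebra_simps)
  show ?thesis
    by (intro linearI eqI) (simp_all add: bilinear_ladd[OF bl] bilinear_lmul[OF bl] e add scale)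
qed

lemma vector_4 [simp]:
  fixes a b c d :: "'a::zero"
  shows "(vector [a, b, c, d] :: 'a^4) $ 1 = a" "(vector [a, b, c, d] :: 'a^4) $ 2 = b"
    "(vector [a, b, c, d] :: 'a^4) $ 3 = c" "(vector [a, b, c, d] :: 'a^4) $ 4 = d"
  by (simp_all add: vector_def)

text \<open>Comparing coefficients in [e2,e4] = e1 gives D11 = D22 + D44; in [e3,e4] = e2 it gives
  D23 = D12 and D22 = D33 + D44. The zero entries make the Leibniz rule hold on the vanishing
  brackets. D13, D14, D24, D34 stay free, since e1, e2, e3 commute with each other and e1 is
  central.\<close>

lemma derivation_g41:
  fixes D :: "real^4^4"
  assumes "D$2$1 = 0" "D$3$1 = 0" "D$4$1 = 0" "D$3$2 = 0" "D$4$2 = 0" "D$4$3 = 0"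
    and "D$2$3 = D$1$2" "D$1$1 = D$2$2 + D$4$4" "D$2$2 = D$3$3 + D$4$4"
  shows "derivation g41_bracket (\<lambda>x. D *v x)"
  unfolding derivation_def
proof (intro conjI allI)
  show "linear (\<lambda>x. D *v x)" by (rule matrix_vector_mul_linear)
  show "D *v g41_bracket x y = g41_bracket (D *v x) y + g41_bracket x (D *v y)" for x y
    by (simp add: g41_bracket_def axis_def vec_eq_iff forall_4 matrix_vector_mult_def sum_4
        assms(1-8)) (simp add: assms(9) algebra_simps)
qed

theorem theorem4p1:
  fixes g :: "real^4 \<Rightarrow> real^4 \<Rightarrow> real"
    and R :: "real^4^4"
  assumes "pseudo_riemannian g"
    and "R = matrix (ricci_operator g41_bracket g)"
    and "R$2$1 = 0" and "R$3$1 = 0" and "R$4$1 = 0"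
    and "R$3$2 = 0" and "R$4$2 = 0" and "R$4$3 = 0"
    and "R$2$3 = R$1$2"
    and "R$2$2 + R$4$4 - R$1$1 = R$3$3 + R$4$4 - R$2$2"
  shows "algebraic_ricci_soliton g41_bracket g \<and>
    (let \<eta> = R$2$2 + R$4$4 - R$1$1;
         D = vector [vector [R$1$1 - \<eta>, R$1$2,       R$1$3,       R$1$4],
                     vector [0,          R$2$2 - \<eta>, R$1$2,       R$2$4],
                     vector [0,          0,           R$3$3 - \<eta>, R$3$4],
                     vector [0,          0,           0,           R$4$4 - \<eta>]] :: real^4^4
     in \<eta> = R$3$3 + R$4$4 - R$2$2 \<and>
        (\<forall>x. ricci_operator g41_bracket g x = \<eta> *\<^sub>R x + D *v x) \<and>
        R = \<eta> *\<^sub>R mat 1 + D \<and>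
        derivation g41_bracket (\<lambda>x. D *v x))"
proof -
  define \<eta> where "\<eta> = R$2$2 + R$4$4 - R$1$1"
  define D :: "real^4^4" where
    "D = vector [vector [R$1$1 - \<eta>, R$1$2,       R$1$3,       R$1$4],
                 vector [0,          R$2$2 - \<eta>, R$1$2,       R$2$4],
                 vector [0,          0,           R$3$3 - \<eta>, R$3$4],
                 vector [0,          0,           0,           R$4$4 - \<eta>]]"
  have br: "bilinear g41_bracket" using lie_bracket_g41 by (simp add: lie_bracket_def)
  have \<eta>: "\<eta> = R$3$3 + R$4$4 - R$2$2" using assms(10) by (simp add: \<eta>_def)
  \<comment> \<open>Entrywise: off the diagonal this is exactly the assumed zeros and
    \<open>R$2$3 = R$1$2\<close>; on it \<eta> cancels.\<close>
  have R: "R = \<eta> *\<^sub>R mat 1 + D"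
    using assms(3-9) by (simp add: vec_eq_iff forall_4 D_def mat_def)
  have "ricci_operator g41_bracket g x = R *v x" for x
    using linear_ricci_operator[OF assms(1) br] by (simp add: assms(2))
  then have Ric: "ricci_operator g41_bracket g x = \<eta> *\<^sub>R x + D *v x" for x
    by (subst (asm) R)
      (simp add: matrix_vector_mult_add_rdistrib scaleR_matrix_vector_assoc[symmetric])
  have der: "derivation g41_bracket (\<lambda>x. D *v x)"
    \<comment> \<open>Two diagonal relations survive \<open>D_def\<close>. Each says that \<eta>
      equals one of its two expressions: the definition settles the first, the fact
      \<open>\<eta>\<close> the second.\<close>
    by (rule derivation_g41) (simp_all add: D_def, simp add: \<eta>_def, simp add: \<eta>)
  have "algebraic_ricci_soliton g41_bracket g"
    unfolding algebraic_ricci_soliton_def using der Ric by blast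
  then show ?thesis
    unfolding Let_def \<eta>_def[symmetric] D_def[symmetric] using \<eta> Ric R der by blast
qed

end
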